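(* Let $p(x)$ be any monic real quartic polynomial and let $a$ be its coefficient of $x^3$. Then Euler's algorithm with the fixed initial position $x^{(0)}=-\frac a4$, $$x^{(k+1)}=x^{(k)}-\Delta x\cdot p'(x^{(k)}),\qquad k=0,1,2,\dots,$$ with sufficiently small step size $\Delta x>0$, converges to the global minimizer of $p(x)$.
   Formalization: The global minimizer of p is assumed to be unique; without this the claim fails, e.g. for x^4 - x^2, where the iteration stays at the local maximum 0. *)

theory Defs
  imports Complex_Main "HOL-Computational_Algebra.Polynomial"
begin

primrec euler_iterates :: "real poly \<Rightarrow> real \<Rightarrow> real \<Rightarrow> nat \<Rightarrow> real" where
  "euler_iterates p h x0 0 = x0"
| "euler_iterates p h x0 (Suc k) =
     euler_iterates p h x0 k - h * poly (pderiv p) (euler_iterates p h x0 k)"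

definition global_minimizer :: "(real \<Rightarrow> real) \<Rightarrow> real \<Rightarrow> bool" where
  "global_minimizer f m \<longleftrightarrow> is_arg_min f (\<lambda>_. True) m"

text \<open>
  ``The'' global minimizer presupposes uniqueness.  A monic quartic always attains
  its minimum, but possibly at two points, e.g. \<open>x^4 - x^2\<close>; there the start point
  \<open>-a/4 = 0\<close> is a critical point that is not a minimizer and the iteration stays at it.
\<close>
definition the_global_minimizer :: "(real \<Rightarrow> real) \<Rightarrow> real \<Rightarrow> bool" where
  "the_global_minimizer f m \<longleftrightarrow>
     global_minimizer f m \<and> (\<forall>y. global_minimizer f y \<longrightarrow> y = m)"

end

theory Submission
  imports Defs
begin

text \<open>
  In the variable \<open>t = x + a/4\<close> the quartic reads \<open>t^4 + A t^2 + B t + C\<close>. Let the minimizer be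
  \<open>s\<close>. Reflecting \<open>s\<close> to \<open>-s\<close> raises the value by \<open>-2 B s\<close>, so uniqueness forces
  \<open>B s < 0\<close> unless \<open>s = 0\<close>, where the start point is already the (critical) minimizer. As \<open>s\<close> is a
  critical point, the derivative factors as \<open>(t - s) (4 (t^2 + t s + s^2) + 2 A)\<close>, and for \<open>t\<close>
  between \<open>0\<close> and \<open>s\<close> the second factor is at least its value \<open>4 s^2 + 2 A = -B / s > 0\<close> at \<open>0\<close>.
  Hence, for small steps, each step shrinks the distance to \<open>s\<close> by a factor bounded away
  from \<open>1\<close>, without overshooting.
\<close>

text \<open>The parameter \<open>e\<close> is the signed fraction of the initial displacement
  \<open>x0 - m\<close> still left, so both orders of \<open>x0\<close> and \<open>m\<close> are
  treated at once. A step multiplies \<open>e\<close> by \<open>1 - h * g e\<close>, which lies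
  between \<open>0\<close> and \<open>1 - h * \<gamma>\<close>; hence \<open>e\<close> stays in the
  unit interval, where \<open>slope\<close> applies, and decays geometrically.\<close>

lemma euler_iterates_linear_convergence:
  fixes x0 m h \<gamma> G :: real
  assumes slope: "\<And>e. 0 \<le> e \<Longrightarrow> e \<le> 1 \<Longrightarrow>
      poly (pderiv p) (m + e * (x0 - m)) = e * (x0 - m) * g e \<and> \<gamma> \<le> g e \<and> g e \<le> G"
    and "0 < \<gamma>" "0 < h" "h * G \<le> 1"
  shows "euler_iterates p h x0 \<longlonglongrightarrow> m"
proof -
  have "\<gamma> \<le> G" using slope[of 0] by linarith
  then have "h * \<gamma> \<le> h * G" using \<open>0 < h\<close> by (simp add: mult_left_mono)
  then have q0: "0 \<le> 1 - h * \<gamma>" using \<open>h * G \<le> 1\<close> by linarith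
  have q1: "1 - h * \<gamma> < 1" using \<open>0 < h\<close> \<open>0 < \<gamma>\<close> by simp
  have inv: "\<exists>e. 0 \<le> e \<and> e \<le> (1 - h * \<gamma>) ^ k \<and> euler_iterates p h x0 k = m + e * (x0 - m)" for k
  proof (induction k)
    case 0
    show ?case by (intro exI[of _ 1]) simp
  next
    case (Suc k)
    then obtain e where e: "0 \<le> e" "e \<le> (1 - h * \<gamma>) ^ k"
      and x: "euler_iterates p h x0 k = m + e * (x0 - m)" by blast
    have "(1 - h * \<gamma>) ^ k \<le> 1" using q0 q1 by (intro power_le_one) auto
    then have s: "poly (pderiv p) (m + e * (x0 - m)) = e * (x0 - m) * g e" "\<gamma> \<le> g e" "g e \<le> G"
      using slope[of e] e by auto
    have "h * \<gamma> \<le> h * g e" "h * g e \<le> h * G" using s \<open>0 < h\<close> by (auto intro: mult_left_mono)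
    then have f: "0 \<le> 1 - h * g e" "1 - h * g e \<le> 1 - h * \<gamma>" using \<open>h * G \<le> 1\<close> by linarith+
    have "(1 - h * g e) * e \<le> (1 - h * \<gamma>) ^ Suc k"
      using mult_mono[OF f(2) e(2) q0 e(1)] by simp
    moreover have "0 \<le> (1 - h * g e) * e" using f(1) e(1) by simp
    moreover have "euler_iterates p h x0 (Suc k) = m + ((1 - h * g e) * e) * (x0 - m)"
      unfolding euler_iterates.simps x s(1) by (simp add: algebra_simps)
    ultimately show ?case by blast
  qed
  have "(\<lambda>k. (1 - h * \<gamma>) ^ k * \<bar>x0 - m\<bar>) \<longlonglongrightarrow> 0"
    using tendsto_mult_left_zero[OF LIMSEQ_realpow_zero[OF q0 q1]] .
  then have "(\<lambda>k. euler_iterates p h x0 k - m) \<longlonglongrightarrow> 0"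
  proof (rule tendsto_0_le[where K = 1], intro always_eventually allI)
    fix k
    have "norm (euler_iterates p h x0 k - m) \<le> (1 - h * \<gamma>) ^ k * \<bar>x0 - m\<bar>"
      using inv[of k] by (auto simp: abs_mult intro!: mult_right_mono)
    then show "norm (euler_iterates p h x0 k - m) \<le> norm ((1 - h * \<gamma>) ^ k * \<bar>x0 - m\<bar>) * 1"
      by simp
  qed
  then show ?thesis by (simp add: LIM_zero_iff)
qed

lemma euler_iterates_critical_point:
  assumes "poly (pderiv p) x = 0"
  shows "euler_iterates p h x k = x"
  by (induction k) (simp_all add: assms)

lemma pderiv_eq_0_global_minimizer:
  assumes "global_minimizer (poly p) m"
  shows "poly (pderiv p) m = 0"
  using assms
  by (intro DERIV_local_min[OF poly_DERIV, of 1])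
     (auto simp: global_minimizer_def is_arg_min_def not_less)

lemma quartic_explicit:
  fixes p :: "'a::comm_semiring_1 poly"
  assumes "degree p = 4" "lead_coeff p = 1"
  shows "p = [:coeff p 0, coeff p 1, coeff p 2, coeff p 3, 1:]"
proof (rule poly_eqI)
  fix n :: nat
  consider "n = 0" | "n = 1" | "n = 2" | "n = 3" | "n = 4" | "n > 4" by linarith
  then show "coeff p n = coeff [:coeff p 0, coeff p 1, coeff p 2, coeff p 3, 1:] n"
    using assms by cases (auto simp: coeff_pCons coeff_eq_0 numeral_eq_Suc split: nat.split)
qed

theorem theorem4p9:
  fixes p :: "real poly" and a m :: real
  assumes "degree p = 4" and "lead_coeff p = 1"
    and "a = coeff p 3"
    and "the_global_minimizer (poly p) m"
  shows "\<exists>\<delta>>0. \<forall>h. 0 < h \<and> h < \<delta> \<longrightarrow> euler_iterates p h (- a / 4) \<longlonglongrightarrow> m"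
proof -
  obtain b c d where p: "p = [:d, c, b, a, 1:]"
    using quartic_explicit[OF assms(1,2)] assms(3) by metis
  define A where "A = b - 3 * a^2 / 8"
  define B where "B = c - a * b / 2 + a^3 / 8"
  define s where "s = m + a / 4"
  have m: "m = s - a / 4" by (simp add: s_def)
  have deriv: "poly (pderiv p) (t - a / 4) = 4 * t^3 + 2 * A * t + B" for t
    by (simp add: p pderiv_pCons A_def B_def field_simps power2_eq_square power3_eq_cube)
  \<comment> \<open>After the shift by \<open>a / 4\<close> the cubic term is gone, so the linear
    term \<open>B * t\<close> is the only odd one.\<close>
  have refl: "poly p (- t - a / 4) = poly p (t - a / 4) - 2 * B * t" for t
    by (simp add: p B_def field_simps power2_eq_square power3_eq_cube)
  have min: "global_minimizer (poly p) m" and unique: "\<And>y. global_minimizer (poly p) y \<Longrightarrow> y = m"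
    using assms(4) by (auto simp: the_global_minimizer_def)
  have crit: "poly (pderiv p) m = 0" using min by (rule pderiv_eq_0_global_minimizer)
  then have B: "B = - (4 * s^3 + 2 * A * s)" using deriv[of s] by (simp add: m)
  show ?thesis
  proof (cases "s = 0")
    case True
    then have "euler_iterates p h (- a / 4) = (\<lambda>_. m)" for h
      using euler_iterates_critical_point[OF crit] by (auto simp: m)
    \<comment> \<open>The iteration is constant for every \<open>h\<close>, so the bound
      \<open>1\<close> is arbitrary.\<close>
    then show ?thesis by (intro exI[of _ 1]) simp
  next
    case False
    have "poly p m < poly p (- s - a / 4)"
    proof (rule ccontr)
      assume "\<not> ?thesis"
      then have "global_minimizer (poly p) (- s - a / 4)"
        using min unfolding global_minimizer_def is_arg_min_def not_less
        by (meson not_less order_trans)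
      then show False using unique m False by force
    qed
    then have "0 < - 2 * B * s" by (simp add: refl m)
    also have "- 2 * B * s = 2 * s^2 * (4 * s^2 + 2 * A)"
      by (simp add: B algebra_simps power2_eq_square power3_eq_cube)
    finally have pos: "0 < 4 * s^2 + 2 * A" using False by (simp add: zero_less_mult_iff)
    \<comment> \<open>This is the second derivative of \<open>p\<close> at \<open>m\<close>, the
      value of the cofactor at \<open>t = s\<close>.\<close>
    let ?G = "12 * s^2 + 2 * A"
    have "0 < ?G" using pos zero_le_power2[of s] by linarith
    \<comment> \<open>Here \<open>t = (1 - e) * s\<close>, and \<open>- a / 4 - m = - s\<close>
      turns \<open>t - s\<close> into \<open>e * (- a / 4 - m)\<close>. The lower bound is attained
      at \<open>e = 1\<close> (the start), the upper one at \<open>e = 0\<close> (the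
      minimizer).\<close>
    have slope: "poly (pderiv p) (m + e * (- a / 4 - m))
          = e * (- a / 4 - m) * (4 * s^2 * ((1 - e)^2 + (1 - e) + 1) + 2 * A) \<and>
        4 * s^2 + 2 * A \<le> 4 * s^2 * ((1 - e)^2 + (1 - e) + 1) + 2 * A \<and>
        4 * s^2 * ((1 - e)^2 + (1 - e) + 1) + 2 * A \<le> ?G" if "0 \<le> e" "e \<le> 1" for e
    proof (intro conjI)
      have arg: "m + e * (- a / 4 - m) = (1 - e) * s - a / 4" by (simp add: m algebra_simps)
      show "poly (pderiv p) (m + e * (- a / 4 - m))
          = e * (- a / 4 - m) * (4 * s^2 * ((1 - e)^2 + (1 - e) + 1) + 2 * A)"
        unfolding arg deriv B by (simp add: m) algebra
      have "(1 - e)^2 \<le> 1" using that by (intro power_le_one) auto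
      then have "s^2 * ((1 - e)^2 + (1 - e) + 1) \<le> s^2 * 3"
        using that by (intro mult_left_mono) auto
      then show "4 * s^2 * ((1 - e)^2 + (1 - e) + 1) + 2 * A \<le> ?G" by linarith
      have "1 \<le> (1 - e)^2 + (1 - e) + 1" using that zero_le_power2[of "1 - e"] by linarith
      then have "s^2 * 1 \<le> s^2 * ((1 - e)^2 + (1 - e) + 1)" by (intro mult_left_mono) auto
      then show "4 * s^2 + 2 * A \<le> 4 * s^2 * ((1 - e)^2 + (1 - e) + 1) + 2 * A" by linarith
    qed
    show ?thesis
    proof (intro exI[of _ "1 / ?G"] conjI allI impI)
      show "0 < 1 / ?G" using \<open>0 < ?G\<close> by simp
      fix h assume h: "0 < h \<and> h < 1 / ?G"
      then have "h * ?G \<le> 1" using \<open>0 < ?G\<close> by (simp add: less_divide_eq)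
      then show "euler_iterates p h (- a / 4) \<longlonglongrightarrow> m"
        using euler_iterates_linear_convergence[OF slope pos] h by blast
    qed
  qed
qed

end
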